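(* Let $f_1(x)=\frac12x^\top Q_1x+b_1^\top x$ and $f_2(x)=\frac12x^\top Q_2x+b_2^\top x+c$ on $\mathbb{R}^n$, where $Q_1,Q_2$ are real symmetric $n\times n$ matrices with $\mathrm{Null}(Q_1)\cap\mathrm{Null}(Q_2)=\{0\}$. Assume that $f_1,f_2$ are not both convex, that $f_2(x)<0$ for some $x$, and that $\{\lambda\ge 0: Q_1+\lambda Q_2\succeq 0\}=[\lambda_1,\lambda_2]$ with $\lambda_1<\lambda_2$. Let $h_i(x)=f_1(x)+\lambda_if_2(x)$, $A_i=Q_1+\lambda_iQ_2$, $i=1,2$, $H(x)=\max\{h_1(x),h_2(x)\}$ and $L=\max\{\lambda_{\max}(A_1),\lambda_{\max}(A_2)\}$. Let $x_0\in\mathbb{R}^n$ and let $\{x_k\}$ be generated by $x_{k+1}=x_k+\beta_kd_k$ with $d_k,\beta_k$ chosen by the rules (1)–(3) given in the context. Assume that $x^*$ is a minimizer of $H$. Then $$H(x_N)-H(x^* )\le\frac LN\|x_0-x^*\|^2 .$$ That is, the number of iterations required for $H(x_N)-H(x^* )\le\epsilon$ is at most $O(1/\epsilon)$.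
   Context: $\|\cdot\|$ is the Euclidean norm, $\lambda_{\max}$ the largest eigenvalue; $N\ge1$ is the iteration number. Rules for $d_k,\beta_k$. When $h_1(x_k)\ne h_2(x_k)$, let $i$ be the index of the active function ($h_i(x_k)=H(x_k)$) and $j\in\{1,2\}\setminus\{i\}$ the other index, and consider the quadratic equation in $\gamma$ $$\mathbf{a}\gamma^2+\mathbf{b}\gamma+\mathbf{c}=0,\qquad(\ast)$$ with $\mathbf{a}=\frac12\nabla h_i(x_k)^\top(A_i-A_j)\nabla h_i(x_k)$, $\mathbf{b}=-(\nabla h_i(x_k)-\nabla h_j(x_k))^\top\nabla h_i(x_k)$, $\mathbf{c}=h_i(x_k)-h_j(x_k)$ (so that $(\ast)$ says $h_1=h_2$ at $x_k-\gamma\nabla h_i(x_k)$). (1) If $h_1(x_k)=h_2(x_k)$: if there is $g_\alpha=\alpha\nabla h_1(x_k)+(1-\alpha)\nabla h_2(x_k)$ with $\alpha\in[0,1]$ and $\nabla h_1(x_k)^\top g_\alpha=\nabla h_2(x_k)^\top g_\alpha$, set $d_k=-g_\alpha$, $\beta_k=1/L$; otherwise set $d_k=-\nabla h_i(x_k)$ for an $i\in\{1,2\}$ such that $\nabla h_1(x_k)^\top\nabla h_2(x_k)\ge\nabla h_i(x_k)^\top\nabla h_i(x_k)$, and $\beta_k=1/L$. (2) If $h_1(x_k)\ne h_2(x_k)$ and $(\ast)$ has no positive solution or every positive solution satisfies $\gamma\ge 1/L$: set $d_k=-\nabla h_i(x_k)$, $\beta_k=1/L$. (3) If $h_1(x_k)\ne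 h_2(x_k)$ and $(\ast)$ has a positive solution $\gamma<1/L$: set $d_k=-\nabla h_i(x_k)$, $\beta_k=\gamma$. *)

theory Defs
  imports "HOL-Analysis.Analysis" "HOL-Library.Landau_Symbols"
begin

definition gradient :: "('a::real_inner \<Rightarrow> real) \<Rightarrow> 'a \<Rightarrow> 'a" where
  "gradient f x = (THE D. GDERIV f x :> D)"

definition null_space :: "real^'n^'m \<Rightarrow> (real^'n) set" where
  "null_space A = {v. A *v v = 0}"

definition psd :: "real^'n^'n \<Rightarrow> bool" where
  "psd A \<longleftrightarrow> transpose A = A \<and> (\<forall>v. 0 \<le> v \<bullet> (A *v v))"

definition eigenvalues :: "real^'n^'n \<Rightarrow> real set" where
  "eigenvalues A = {l. \<exists>v. v \<noteq> 0 \<and> A *v v = l *\<^sub>R v}"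

(* Used for symmetric matrices only, where the set of real eigenvalues is finite and nonempty. *)
definition lambda_max :: "real^'n^'n \<Rightarrow> real" where
  "lambda_max A = Max (eigenvalues A)"

(* The left-hand side of the quadratic equation a g^2 + b g + c = 0 in g; for the quadratic
   functions h i with Hessians A i it equals h i - h j at the point x - g * gradient (h i) x. *)
definition crossing_poly ::
  "(nat \<Rightarrow> real^'n \<Rightarrow> real) \<Rightarrow> (nat \<Rightarrow> real^'n^'n) \<Rightarrow> real^'n \<Rightarrow> nat \<Rightarrow> nat \<Rightarrow> real \<Rightarrow> real" where
  "crossing_poly h A x i j g =
     (let a = 1/2 * (gradient (h i) x \<bullet> ((A i - A j) *v gradient (h i) x));
          b = - ((gradient (h i) x - gradient (h j) x) \<bullet> gradient (h i) x);
          c = h i x - h j x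
      in a * g\<^sup>2 + b * g + c)"

definition equalizing ::
  "(nat \<Rightarrow> real^'n \<Rightarrow> real) \<Rightarrow> real^'n \<Rightarrow> real^'n \<Rightarrow> bool" where
  "equalizing h x g \<longleftrightarrow>
     (\<exists>\<alpha>\<in>{0..1}. g = \<alpha> *\<^sub>R gradient (h 1) x + (1 - \<alpha>) *\<^sub>R gradient (h 2) x) \<and>
     gradient (h 1) x \<bullet> g = gradient (h 2) x \<bullet> g"

(* step_choice h A L x d t: at the point x, the direction d and the step size t may be chosen.
   It is a relation because the rules leave choices open (which g, which i, which root).
   The condition {i, j} = {1, 2} makes i, j the two indices in some order. *)
inductive step_choice ::
  "(nat \<Rightarrow> real^'n \<Rightarrow> real) \<Rightarrow> (nat \<Rightarrow> real^'n^'n) \<Rightarrow> real \<Rightarrow> real^'n \<Rightarrow> real^'n \<Rightarrow> real \<Rightarrow> bool"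
  for h A L x where
  equal_combination:
    "\<lbrakk>h 1 x = h 2 x; equalizing h x g\<rbrakk> \<Longrightarrow> step_choice h A L x (- g) (1 / L)"
| equal_single:
    "\<lbrakk>h 1 x = h 2 x; \<nexists>g. equalizing h x g; i \<in> {1, 2};
      gradient (h 1) x \<bullet> gradient (h 2) x \<ge> gradient (h i) x \<bullet> gradient (h i) x\<rbrakk>
     \<Longrightarrow> step_choice h A L x (- gradient (h i) x) (1 / L)"
| full_step:
    "\<lbrakk>{i, j} = {1, 2}; h 1 x \<noteq> h 2 x; h i x = max (h 1 x) (h 2 x);
      \<forall>g>0. crossing_poly h A x i j g = 0 \<longrightarrow> g \<ge> 1 / L\<rbrakk>
     \<Longrightarrow> step_choice h A L x (- gradient (h i) x) (1 / L)"
| crossing_step: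
    "\<lbrakk>{i, j} = {1, 2}; h 1 x \<noteq> h 2 x; h i x = max (h 1 x) (h 2 x);
      g > 0; g < 1 / L; crossing_poly h A x i j g = 0\<rbrakk>
     \<Longrightarrow> step_choice h A L x (- gradient (h i) x) g"

end

theory Submission
  imports Defs
begin

text \<open>Every step moves along \<open>- g\<close> for a subgradient \<open>g\<close> of \<open>H\<close> that does not increase the
  maximum, so the usual analysis of gradient descent gives
  \<open>2 \<beta> (H x' - H z) \<le> |x - z|\<^sup>2 - |x' - z|\<^sup>2\<close> for a step of size \<open>\<beta>\<close> from \<open>x\<close> to \<open>x'\<close> and a
  minimizer \<open>z\<close>. Only crossing steps have \<open>\<beta> < 1 / L\<close>; they lose nothing and end at a point where
  \<open>h 1 = h 2\<close>, so no two of them are consecutive and at least every other step gains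
  \<open>2 / L * (H x' - H z)\<close>. The half step missing when \<open>N\<close> is odd and the last step is a crossing
  is recovered from \<open>H y - H z \<le> L / 2 * |y - z|\<^sup>2\<close>, valid wherever \<open>h 1 y = h 2 y\<close>.\<close>

section \<open>Symmetric matrices, their largest eigenvalue, and gradients of quadratics\<close>

lemma symmetric_dot_matrix:
  fixes M :: "real^'n^'n"
  assumes "transpose M = M"
  shows "u \<bullet> (M *v v) = v \<bullet> (M *v u)"
  by (metis assms dot_lmul_matrix inner_commute transpose_matrix_vector)

text \<open>The form is nonnegative, so \<open>u\<close> minimizes it and the first-order term there
  must vanish. If \<open>M *v u\<close> were nonzero, a small step from \<open>u\<close> against it
  would make the form negative.\<close>

lemma psd_dot_zero_imp_kernel:
  fixes M :: "real^'n^'n"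
  assumes "psd M" and u: "u \<bullet> (M *v u) = 0"
  shows "M *v u = 0"
proof -
  define w where "w = M *v u"
  define q where "q = w \<bullet> (M *v w)"
  have sym: "transpose M = M" and pos: "\<And>v. 0 \<le> v \<bullet> (M *v v)"
    using assms by (auto simp: psd_def)
  have quad: "0 \<le> 2 * t * (w \<bullet> w) + t\<^sup>2 * q" for t
  proof -
    have "u \<bullet> (M *v w) = w \<bullet> w"
      using symmetric_dot_matrix[OF sym, of u w] by (simp add: w_def)
    then have "(u + t *\<^sub>R w) \<bullet> (M *v (u + t *\<^sub>R w)) = 2 * t * (w \<bullet> w) + t\<^sup>2 * q"
      using u by (simp add: matrix_vector_right_distrib matrix_vector_mult_scaleR inner_add_left
          inner_add_right q_def w_def[symmetric] power2_eq_square algebra_simps)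
    with pos[of "u + t *\<^sub>R w"] show ?thesis by simp
  qed
  have "q \<ge> 0" using pos q_def by simp
  have "w \<bullet> w = 0"
  proof (rule ccontr)
    assume "w \<bullet> w \<noteq> 0"
    then have w: "w \<bullet> w > 0" by simp
    \<comment> \<open>Close to the minimizer of the quadratic in \<open>t\<close>; the
      \<open>+ 1\<close> keeps the denominator positive when \<open>q = 0\<close>. It gives
      \<open>2 * (w \<bullet> w) + t * q = w \<bullet> w - t\<close>, which is positive.\<close>
    define t where "t = - (w \<bullet> w) / (q + 1)"
    have "t * (q + 1) = - (w \<bullet> w)" using \<open>q \<ge> 0\<close> by (simp add: t_def)
    then have "t * q + t = - (w \<bullet> w)" by (simp add: distrib_left)
    moreover have "t < 0" using w \<open>q \<ge> 0\<close> by (simp add: t_def field_simps)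
    ultimately have "2 * (w \<bullet> w) + t * q > 0"
      using w by linarith
    with \<open>t < 0\<close> have "t * (2 * (w \<bullet> w) + t * q) < 0" by (rule mult_neg_pos)
    with quad[of t] show False by (simp add: power2_eq_square algebra_simps)
  qed
  then show ?thesis by (simp add: w_def)
qed

text \<open>Eigenvectors for distinct eigenvalues are orthogonal, hence independent, and the
  dimension bounds their number. Finiteness makes the \<open>Max\<close> in
  \<open>lambda_max\<close> an upper bound.\<close>

lemma finite_eigenvalues:
  fixes M :: "real^'n^'n"
  assumes sym: "transpose M = M"
  shows "finite (eigenvalues M)"
proof -
  have "\<forall>l\<in>eigenvalues M. \<exists>v. v \<noteq> 0 \<and> M *v v = l *\<^sub>R v" by (simp add: eigenvalues_def)
  then obtain e where e: "\<And>l. l \<in> eigenvalues M \<Longrightarrow> e l \<noteq> 0 \<and> M *v e l = l *\<^sub>R e l"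
    by metis
  have ortho: "e l \<bullet> e m = 0" if "l \<in> eigenvalues M" "m \<in> eigenvalues M" "l \<noteq> m" for l m
  proof -
    have "m * (e l \<bullet> e m) = l * (e l \<bullet> e m)"
      using symmetric_dot_matrix[OF sym, of "e l" "e m"] e[OF that(1)] e[OF that(2)]
      by (simp add: inner_commute)
    with \<open>l \<noteq> m\<close> show ?thesis by simp
  qed
  have inj: "inj_on e (eigenvalues M)"
    by (rule inj_onI) (metis e inner_eq_zero_iff ortho)
  have "pairwise orthogonal (e ` eigenvalues M)"
    unfolding pairwise_def orthogonal_def using ortho by fastforce
  moreover have "0 \<notin> e ` eigenvalues M" using e by force
  ultimately have "independent (e ` eigenvalues M)"
    by (rule pairwise_orthogonal_independent)
  then have "finite (e ` eigenvalues M)" using independent_bound by blast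
  then show ?thesis using inj by (simp add: finite_image_iff)
qed

text \<open>The maximum \<open>m\<close> of the form over the unit sphere is itself an eigenvalue:
  \<open>m *\<^sub>R mat 1 - M\<close> is positive semidefinite and its form vanishes at a maximizer
  \<open>u\<close>, so \<open>u\<close> lies in its kernel.\<close>

lemma rayleigh_le_lambda_max:
  fixes M :: "real^'n^'n"
  assumes sym: "transpose M = M"
  shows "v \<bullet> (M *v v) \<le> lambda_max M * (v \<bullet> v)"
proof -
  have "continuous_on (sphere 0 1) (\<lambda>u. u \<bullet> (M *v u))"
    by (intro continuous_on_inner continuous_on_id linear_continuous_on
        matrix_vector_mul_bounded_linear)
  moreover have "sphere (0::real^'n) 1 \<noteq> {}" by simp
  ultimately obtain u where u: "u \<in> sphere 0 1"
    and u_max: "\<And>y. y \<in> sphere 0 1 \<Longrightarrow> y \<bullet> (M *v y) \<le> u \<bullet> (M *v u)"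
    using continuous_attains_sup[OF compact_sphere, of 0 1 "\<lambda>u. u \<bullet> (M *v u)"] by blast
  define m where "m = u \<bullet> (M *v u)"
  have bound: "y \<bullet> (M *v y) \<le> m * (y \<bullet> y)" for y
  proof (cases "y = 0")
    case False
    have "y \<bullet> (M *v y) / (norm y)\<^sup>2 \<le> m"
      using u_max[of "y /\<^sub>R norm y"] False
      by (simp add: m_def matrix_vector_mult_scaleR power2_eq_square field_simps)
    then show ?thesis using False by (simp add: field_simps power2_norm_eq_inner)
  qed simp
  define B where "B = m *\<^sub>R mat 1 - M"
  have B: "B *v y = m *\<^sub>R y - M *v y" for y
    by (simp add: B_def matrix_vector_mult_diff_rdistrib flip: scaleR_matrix_vector_assoc)
  have "transpose B = B"
    using sym by (simp add: B_def vec_eq_iff transpose_def mat_def)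
  then have "psd B" using bound by (simp add: psd_def B inner_diff_right)
  moreover have "u \<bullet> (B *v u) = 0"
    using u by (simp add: B inner_diff_right m_def dot_square_norm)
  ultimately have "M *v u = m *\<^sub>R u" using psd_dot_zero_imp_kernel B by fastforce
  moreover have "u \<noteq> 0" using u by auto
  ultimately have "m \<in> eigenvalues M" by (auto simp: eigenvalues_def)
  then have "m \<le> lambda_max M"
    unfolding lambda_max_def by (simp add: Max_ge finite_eigenvalues[OF sym])
  then show ?thesis using bound[of v] mult_right_mono[of m "lambda_max M" "v \<bullet> v"] by simp
qed

text \<open>As \<open>gradient\<close> is a definite description, the derivative must be shown to be
  unique as well as correct.\<close>

lemma gradient_quadratic:
  fixes M :: "real^'n^'n"
  assumes sym: "transpose M = M"
  shows "gradient (\<lambda>y. 1/2 * (y \<bullet> (M *v y)) + b \<bullet> y + c) x = M *v x + b"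
proof -
  have deriv: "GDERIV (\<lambda>y. 1/2 * (y \<bullet> (M *v y)) + b \<bullet> y + c) x :> M *v x + b"
    unfolding gderiv_def
    by (rule has_derivative_eq_rhs, (rule derivative_intros
          bounded_linear.has_derivative[OF matrix_vector_mul_bounded_linear])+)
      (auto simp: fun_eq_iff inner_add_left inner_add_right inner_commute
        symmetric_dot_matrix[OF sym, of x])
  show ?thesis
    unfolding gradient_def
  proof (rule the_equality)
    show "GDERIV (\<lambda>y. 1/2 * (y \<bullet> (M *v y)) + b \<bullet> y + c) x :> M *v x + b" by (fact deriv)
  next
    fix D
    assume "GDERIV (\<lambda>y. 1/2 * (y \<bullet> (M *v y)) + b \<bullet> y + c) x :> D"
    then have "(\<lambda>k. k \<bullet> D) = (\<lambda>k. k \<bullet> (M *v x + b))"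
      using deriv unfolding gderiv_def by (rule has_derivative_unique)
    then show "D = M *v x + b" by (simp only: fun_eq_iff vector_eq_ldot)
  qed
qed

section \<open>The maximum of two convex quadratics with curvature at most \<open>L\<close>\<close>

locale max_quadratic =
  fixes h :: "nat \<Rightarrow> real^'n \<Rightarrow> real" and A :: "nat \<Rightarrow> real^'n^'n"
    and b :: "nat \<Rightarrow> real^'n" and c :: "nat \<Rightarrow> real" and L :: real
  assumes h_eq: "\<And>i. h i = (\<lambda>y. 1/2 * (y \<bullet> (A i *v y)) + b i \<bullet> y + c i)"
    and sym_A: "\<And>i. transpose (A i) = A i"
    and convex_A: "\<And>i v. i \<in> {1, 2} \<Longrightarrow> 0 \<le> v \<bullet> (A i *v v)"
    and smooth_A: "\<And>i v. i \<in> {1, 2} \<Longrightarrow> v \<bullet> (A i *v v) \<le> L * (v \<bullet> v)"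
    and L_pos: "0 < L"
begin

definition H where "H y = max (h 1 y) (h 2 y)"

abbreviation G where "G i \<equiv> gradient (h i)"

lemma taylor: "h i (x + v) = h i x + G i x \<bullet> v + 1/2 * (v \<bullet> (A i *v v))"
  unfolding h_eq gradient_quadratic[OF sym_A]
  using symmetric_dot_matrix[OF sym_A, of x i v]
  by (simp add: matrix_vector_right_distrib inner_add_left inner_add_right
      inner_commute field_simps)

lemma h_ge: "i \<in> {1, 2} \<Longrightarrow> h i y \<ge> h i x + G i x \<bullet> (y - x)"
  using taylor[of i x "y - x"] convex_A[of i "y - x"] by simp

lemma h_le: "i \<in> {1, 2} \<Longrightarrow> h i (x + v) \<le> h i x + G i x \<bullet> v + L / 2 * (v \<bullet> v)"
  using taylor[of i x v] smooth_A[of i v] by simp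

text \<open>For \<open>t \<le> 1 / L\<close> the curvature term costs at most half of the linear
  gain. Since \<open>g\<close> may differ from \<open>G i x\<close>, one direction can be shown to
  decrease both functions.\<close>

lemma h_step_le:
  assumes "i \<in> {1, 2}" "0 \<le> t" "t \<le> 1 / L" "G i x \<bullet> g \<ge> g \<bullet> g"
  shows "h i (x + t *\<^sub>R - g) \<le> h i x - t / 2 * (g \<bullet> g)"
proof -
  have "h i (x + t *\<^sub>R - g) \<le> h i x - t * (G i x \<bullet> g) + L / 2 * (t * (t * (g \<bullet> g)))"
    using h_le[OF assms(1), of x "t *\<^sub>R - g"] by simp
  moreover have "t * (G i x \<bullet> g) \<ge> t * (g \<bullet> g)"
    using assms by (simp add: mult_left_mono)
  moreover have "(L * t) * (t * (g \<bullet> g)) \<le> 1 * (t * (g \<bullet> g))"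
    using assms L_pos by (intro mult_right_mono) (auto simp: field_simps)
  ultimately show ?thesis by (simp add: algebra_simps)
qed

text \<open>Both Taylor expansions along the step are exact, so roots of the polynomial are the step
  sizes at which the two functions agree.\<close>

lemma crossing_poly_eq:
  "crossing_poly h A x i j g = h i (x + g *\<^sub>R - G i x) - h j (x + g *\<^sub>R - G i x)"
  unfolding crossing_poly_def Let_def taylor
  by (simp add: matrix_vector_mult_diff_rdistrib matrix_vector_mult_scaleR
      inner_diff_left inner_diff_right power2_eq_square
      linear_neg[OF matrix_vector_mul_linear] algebra_simps)

text \<open>Weights \<open>\<alpha>\<close>, \<open>1 - \<alpha>\<close> concentrated on the active functions, so that
  \<open>g\<close> is a subgradient of \<open>H\<close> at \<open>x\<close>.\<close>

definition active_combination :: "real^'n \<Rightarrow> real^'n \<Rightarrow> real \<Rightarrow> bool" where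
  "active_combination x g \<alpha> \<longleftrightarrow> \<alpha> \<in> {0..1} \<and> g = \<alpha> *\<^sub>R G 1 x + (1 - \<alpha>) *\<^sub>R G 2 x \<and>
     \<alpha> * h 1 x + (1 - \<alpha>) * h 2 x = H x"

lemma convex_combination_le_H: "\<alpha> \<in> {0..1} \<Longrightarrow> \<alpha> * h 1 y + (1 - \<alpha>) * h 2 y \<le> H y"
  unfolding H_def by (rule convex_bound_le) auto

text \<open>Average the gradient inequalities of \<open>h 1\<close> and \<open>h 2\<close>: the
  weights reproduce \<open>H x\<close> at \<open>x\<close>, and an average never exceeds the maximum
  at \<open>y\<close>.\<close>

lemma active_combination_subgradient:
  assumes "active_combination x g \<alpha>"
  shows "H x + g \<bullet> (y - x) \<le> H y"
proof -
  have \<alpha>: "\<alpha> \<in> {0..1}" using assms by (simp add: active_combination_def)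
  have "\<alpha> * (h 1 x + G 1 x \<bullet> (y - x)) + (1 - \<alpha>) * (h 2 x + G 2 x \<bullet> (y - x))
      \<le> \<alpha> * h 1 y + (1 - \<alpha>) * h 2 y"
    using \<alpha> by (intro add_mono mult_left_mono h_ge) auto
  also have "\<dots> \<le> H y" using \<alpha> by (rule convex_combination_le_H)
  also have "\<alpha> * (h 1 x + G 1 x \<bullet> (y - x)) + (1 - \<alpha>) * (h 2 x + G 2 x \<bullet> (y - x)) =
      (\<alpha> * h 1 x + (1 - \<alpha>) * h 2 x) + (\<alpha> *\<^sub>R G 1 x + (1 - \<alpha>) *\<^sub>R G 2 x) \<bullet> (y - x)"
    unfolding inner_add_left inner_scaleR_left by (simp add: algebra_simps)
  also have "\<dots> = H x + g \<bullet> (y - x)"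
    using assms by (simp add: active_combination_def)
  finally show ?thesis .
qed

lemma active_combination_single:
  assumes "i \<in> {1, 2}" "h i x = H x"
  shows "\<exists>\<alpha>. active_combination x (G i x) \<alpha>"
proof (cases "i = 1")
  case True
  with assms have "active_combination x (G i x) 1" by (simp add: active_combination_def)
  then show ?thesis ..
next
  case False
  with assms have "active_combination x (G i x) 0" by (simp add: active_combination_def)
  then show ?thesis ..
qed

section \<open>The step rules: consequences, availability, and stationarity at a minimizer\<close>

text \<open>Collects what the convergence analysis needs from the four rules. By the last fact, a
  step shorter than \<open>1 / L\<close> starts where \<open>h 1\<close> and \<open>h 2\<close>
  differ and ends where they agree.\<close>

lemma step_choice_sound:
  assumes "step_choice h A L x d t"
  obtains g \<alpha> where "d = - g" "active_combination x g \<alpha>" "0 < t" "t \<le> 1 / L"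
    "H (x + t *\<^sub>R d) \<le> H x - t / 2 * (g \<bullet> g)"
    "t = 1 / L \<or> h 1 x \<noteq> h 2 x \<and> h 1 (x + t *\<^sub>R d) = h 2 (x + t *\<^sub>R d)"
  using assms
proof cases
  case (equal_combination g)
  then obtain \<alpha> where \<alpha>: "\<alpha> \<in> {0..1}" "g = \<alpha> *\<^sub>R G 1 x + (1 - \<alpha>) *\<^sub>R G 2 x"
    and eq: "G 1 x \<bullet> g = G 2 x \<bullet> g" by (auto simp: equalizing_def)
  \<comment> \<open>Expanding one factor makes \<open>g \<bullet> g\<close> an average of two equal
    numbers, so it equals both of them.\<close>
  have "g \<bullet> g = \<alpha> * (G 1 x \<bullet> g) + (1 - \<alpha>) * (G 2 x \<bullet> g)"
    by (subst (1) \<alpha>(2)) (simp add: inner_add_left)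
  then have "G i x \<bullet> g = g \<bullet> g" if "i \<in> {1, 2}" for i
    using that eq by (auto simp: algebra_simps)
  then have "h i (x + t *\<^sub>R d) \<le> h i x - t / 2 * (g \<bullet> g)" if "i \<in> {1, 2}" for i
    unfolding equal_combination using that L_pos by (intro h_step_le) auto
  from this[of 1] this[of 2] have "H (x + t *\<^sub>R d) \<le> H x - t / 2 * (g \<bullet> g)"
    by (auto simp: H_def max_def)
  moreover have "active_combination x g \<alpha>"
    using \<alpha> equal_combination by (simp add: active_combination_def H_def algebra_simps)
  ultimately show ?thesis using that equal_combination L_pos by simp
next
  case (equal_single i)
  \<comment> \<open>For \<open>j = i\<close> this is an equality; for the other index it is the
    condition in the rule.\<close>
  have "G j x \<bullet> G i x \<ge> G i x \<bullet> G i x" if "j \<in> {1, 2}" for j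
    using that equal_single by (auto simp: inner_commute)
  then have "h j (x + t *\<^sub>R d) \<le> h j x - t / 2 * (G i x \<bullet> G i x)" if "j \<in> {1, 2}" for j
    unfolding equal_single using that L_pos by (intro h_step_le) auto
  from this[of 1] this[of 2] have "H (x + t *\<^sub>R d) \<le> H x - t / 2 * (G i x \<bullet> G i x)"
    by (auto simp: H_def max_def)
  moreover have "h i x = H x" using equal_single by (auto simp: H_def)
  then obtain \<alpha> where "active_combination x (G i x) \<alpha>"
    using active_combination_single equal_single by blast
  ultimately show ?thesis using that equal_single L_pos by simp
next
  case (full_step i j)
  have i: "i \<in> {1, 2}" and active: "h i x = H x"
    using full_step by (auto simp: H_def)
  have H_alt: "H y = max (h i y) (h j y)" for y
    using full_step(3) by (auto simp: H_def doubleton_eq_iff)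
  have gap: "h j x < h i x"
    using full_step(3-5) by (auto simp: doubleton_eq_iff)
  let ?\<phi> = "\<lambda>s. crossing_poly h A x i j s"
  \<comment> \<open>The active function stays on top after the full step: \<open>?\<phi>\<close> is
    positive at 0, and a negative value at \<open>1 / L\<close> would force a root strictly in
    between, which the rule excludes.\<close>
  have "?\<phi> (1 / L) \<ge> 0"
  proof (rule ccontr)
    assume neg: "\<not> ?\<phi> (1 / L) \<ge> 0"
    have "continuous_on {0..1/L} ?\<phi>"
      unfolding crossing_poly_def Let_def by (intro continuous_intros)
    moreover have "?\<phi> 0 > 0" using gap by (simp add: crossing_poly_eq)
    ultimately obtain s where "0 \<le> s" "s \<le> 1 / L" "?\<phi> s = 0"
      using IVT2'[of ?\<phi> "1 / L" 0 0] neg L_pos by auto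
    then have "0 < s" "s < 1 / L" using \<open>?\<phi> 0 > 0\<close> neg by (auto simp: order_less_le)
    with full_step(6) \<open>?\<phi> s = 0\<close> show False by (meson not_le)
  qed
  then have "H (x + t *\<^sub>R d) = h i (x + t *\<^sub>R d)"
    unfolding H_alt full_step(1,2) by (simp add: crossing_poly_eq)
  moreover have "h i (x + t *\<^sub>R d) \<le> h i x - t / 2 * (G i x \<bullet> G i x)"
    unfolding full_step(1,2) using i L_pos by (intro h_step_le) auto
  moreover obtain \<alpha> where "active_combination x (G i x) \<alpha>"
    using active_combination_single i active by blast
  ultimately show ?thesis using that full_step L_pos active by simp
next
  case (crossing_step i j)
  have i: "i \<in> {1, 2}" and active: "h i x = H x"
    using crossing_step by (auto simp: H_def)
  have cross: "h i (x + t *\<^sub>R d) = h j (x + t *\<^sub>R d)"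
    using crossing_step(7) unfolding crossing_step(1) by (simp add: crossing_poly_eq)
  then have H_next: "H (x + t *\<^sub>R d) = h i (x + t *\<^sub>R d)"
    and equal: "h 1 (x + t *\<^sub>R d) = h 2 (x + t *\<^sub>R d)"
    using crossing_step(2) by (auto simp: H_def doubleton_eq_iff)
  have "h i (x + t *\<^sub>R d) \<le> h i x - t / 2 * (G i x \<bullet> G i x)"
    unfolding crossing_step(1) using i crossing_step by (intro h_step_le) auto
  moreover obtain \<alpha> where "active_combination x (G i x) \<alpha>"
    using active_combination_single i active by blast
  ultimately show ?thesis
    using that[of "G i x" \<alpha>] crossing_step H_next equal active by simp
qed

text \<open>Lets a step be taken from an arbitrary point, in particular from a minimizer, where it
  shows stationarity.\<close>

lemma step_choice_exists: "\<exists>d t. step_choice h A L x d t"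
proof (cases "h 1 x = h 2 x")
  case eq: True
  show ?thesis
  proof (cases "\<exists>g. equalizing h x g")
    case True
    then show ?thesis using eq step_choice.equal_combination by blast
  next
    case False
    let ?p = "G 1 x" and ?q = "G 2 x"
    have "\<exists>i\<in>{1, 2}. ?p \<bullet> ?q \<ge> G i x \<bullet> G i x"
    proof (rule ccontr)
      assume "\<not> ?thesis"
      then have less: "?p \<bullet> ?q < ?p \<bullet> ?p" "?p \<bullet> ?q < ?q \<bullet> ?q" by auto
      \<comment> \<open>Here \<open>s\<close> is the squared distance of \<open>?p\<close> and
        \<open>?q\<close>, and \<open>\<alpha>\<close> gives the projection of the origin onto the
        line through them. That point is orthogonal to \<open>?p - ?q\<close>, hence equalizing; the
        strict inequalities put it on the segment.\<close>
      define s where "s = ?p \<bullet> ?p - 2 * (?p \<bullet> ?q) + ?q \<bullet> ?q"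
      define \<alpha> where "\<alpha> = (?q \<bullet> ?q - ?p \<bullet> ?q) / s"
      have "s > 0" using less by (simp add: s_def)
      then have "\<alpha> \<in> {0..1}" using less by (simp add: \<alpha>_def field_simps) (simp add: s_def)
      moreover have "\<alpha> * s = ?q \<bullet> ?q - ?p \<bullet> ?q" using \<open>s > 0\<close> by (simp add: \<alpha>_def)
      then have "?p \<bullet> (\<alpha> *\<^sub>R ?p + (1 - \<alpha>) *\<^sub>R ?q) = ?q \<bullet> (\<alpha> *\<^sub>R ?p + (1 - \<alpha>) *\<^sub>R ?q)"
        by (simp add: s_def inner_add_right inner_commute algebra_simps)
      ultimately show False using False unfolding equalizing_def by blast
    qed
    then show ?thesis using eq False step_choice.equal_single by blast
  qed
next
  case False
  obtain i j where ij: "{i, j} = {1, 2::nat}" "h i x = max (h 1 x) (h 2 x)"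
    by (metis insert_commute max_def)
  show ?thesis
  proof (cases "\<forall>g>0. crossing_poly h A x i j g = 0 \<longrightarrow> g \<ge> 1 / L")
    case True
    then show ?thesis using step_choice.full_step[of i j h x A L] ij False by blast
  next
    case no_full: False
    then show ?thesis using step_choice.crossing_step[of i j h x _ L A] ij False
      by (metis not_le)
  qed
qed

text \<open>The method is stationary at a minimizer, which yields Lagrange multipliers there; where
  \<open>h 1 = h 2\<close>, the multipliers turn \<open>H\<close> into a smooth function with a critical point at
  \<open>z\<close>.\<close>

lemma H_gap_at_equal:
  assumes min: "\<And>y. H z \<le> H y" and eq: "h 1 y = h 2 y"
  shows "H y - H z \<le> L / 2 * (norm (y - z))\<^sup>2"
proof -
  obtain d t where "step_choice h A L z d t" using step_choice_exists by blast
  then obtain g \<alpha> where g: "active_combination z g \<alpha>" "0 < t"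
    "H (z + t *\<^sub>R d) \<le> H z - t / 2 * (g \<bullet> g)"
    by (rule step_choice_sound)
  then have "t / 2 * (g \<bullet> g) \<le> 0" using min[of "z + t *\<^sub>R d"] by simp
  then have "g = 0"
    using \<open>0 < t\<close> by (metis half_gt_zero inner_gt_zero_iff mult_pos_pos not_le)
  then have \<alpha>: "\<alpha> \<in> {0..1}" "\<alpha> * h 1 z + (1 - \<alpha>) * h 2 z = H z"
    and stationary: "(\<alpha> *\<^sub>R G 1 z + (1 - \<alpha>) *\<^sub>R G 2 z) \<bullet> (y - z) = 0"
    using g(1) by (auto simp: active_combination_def)
  let ?r = "L / 2 * ((y - z) \<bullet> (y - z))"
  have "H y = \<alpha> * h 1 y + (1 - \<alpha>) * h 2 y"
    using eq by (simp add: H_def algebra_simps)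
  also have "\<dots> \<le> \<alpha> * (h 1 z + G 1 z \<bullet> (y - z) + ?r) + (1 - \<alpha>) * (h 2 z + G 2 z \<bullet> (y - z) + ?r)"
    using \<alpha> h_le[of 1 z "y - z"] h_le[of 2 z "y - z"] by (intro add_mono mult_left_mono) auto
  also have "\<dots> = H z + ?r"
  proof -
    have "\<alpha> * (a + p + r) + (1 - \<alpha>) * (b + q + r) =
        (\<alpha> * a + (1 - \<alpha>) * b) + (\<alpha> * p + (1 - \<alpha>) * q) + r" for a b p q r :: real
      by (simp add: algebra_simps)
    then show ?thesis
      using \<alpha>(2) stationary by (simp add: inner_add_left)
  qed
  finally show ?thesis by (simp add: power2_norm_eq_inner)
qed

section \<open>Convergence rate of the iteration\<close>

text \<open>Add the subgradient inequality at \<open>z\<close> to the decrease of \<open>H\<close>,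
  multiply by \<open>2 * t\<close>, and complete the square: the right-hand side becomes a
  difference of squared distances to \<open>z\<close>.\<close>

lemma step_decrease:
  assumes "step_choice h A L x d t"
  shows "2 * t * (H (x + t *\<^sub>R d) - H z) \<le> (norm (x - z))\<^sup>2 - (norm (x + t *\<^sub>R d - z))\<^sup>2"
    and "H (x + t *\<^sub>R d) \<le> H x"
proof -
  obtain g \<alpha> where g: "d = - g" "active_combination x g \<alpha>" "0 < t"
    "H (x + t *\<^sub>R d) \<le> H x - t / 2 * (g \<bullet> g)"
    using assms by (rule step_choice_sound)
  show "H (x + t *\<^sub>R d) \<le> H x"
    using g by (smt (verit) inner_ge_zero mult_nonneg_nonneg half_gt_zero)
  have "H (x + t *\<^sub>R d) - H z \<le> g \<bullet> (x - z) - t / 2 * (g \<bullet> g)"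
    using active_combination_subgradient[OF g(2), of z] g(4)
    by (simp add: inner_diff_right)
  then have "2 * t * (H (x + t *\<^sub>R d) - H z) \<le> 2 * t * (g \<bullet> (x - z) - t / 2 * (g \<bullet> g))"
    using g(3) by (intro mult_left_mono) auto
  also have "\<dots> = (norm (x - z))\<^sup>2 - (norm (x + t *\<^sub>R d - z))\<^sup>2"
    unfolding g(1) power2_norm_eq_inner
    by (simp add: inner_diff_left inner_diff_right inner_commute algebra_simps)
  finally show "2 * t * (H (x + t *\<^sub>R d) - H z) \<le> \<dots>" .
qed

text \<open>A crossing step ends where \<open>h 1 = h 2\<close>, so the step after it has length \<open>1 / L\<close> and
  is worth two iterations of the claimed rate.\<close>

lemma iteration_potential:
  assumes choice: "\<And>k. step_choice h A L (x k) (d k) (\<beta> k)"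
    and step: "\<And>k. x (Suc k) = x k + \<beta> k *\<^sub>R d k"
    and min: "\<And>y. H z \<le> H y"
  shows "real N * (H (x N) - H z) + L * (norm (x N - z))\<^sup>2 \<le> L * (norm (x 0 - z))\<^sup>2 \<or>
    h 1 (x N) = h 2 (x N) \<and>
    (real N - 1) * (H (x N) - H z) + L * (norm (x N - z))\<^sup>2 \<le> L * (norm (x 0 - z))\<^sup>2"
proof (induction N)
  case (Suc N)
  define \<delta> where "\<delta> k = H (x k) - H z" for k
  define D where "D k = (norm (x k - z))\<^sup>2" for k
  have nonneg: "\<delta> k \<ge> 0" for k using min by (simp add: \<delta>_def)
  obtain g \<alpha> where t: "0 < \<beta> N"
    and cases: "\<beta> N = 1 / L \<or> h 1 (x N) \<noteq> h 2 (x N) \<and> h 1 (x (Suc N)) = h 2 (x (Suc N))"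
    unfolding step using choice[of N] by (rule step_choice_sound)
  have mono: "\<delta> (Suc N) \<le> \<delta> N"
    and dec: "2 * \<beta> N * \<delta> (Suc N) \<le> D N - D (Suc N)"
    using step_decrease[OF choice[of N]] by (simp_all add: \<delta>_def D_def step)
  have IH: "real N * \<delta> N + L * D N \<le> L * D 0 \<or>
      h 1 (x N) = h 2 (x N) \<and> (real N - 1) * \<delta> N + L * D N \<le> L * D 0"
    using Suc.IH by (simp add: \<delta>_def D_def)
  show ?case
    using cases
  proof
    assume "\<beta> N = 1 / L"
    \<comment> \<open>Two units of \<open>\<delta> (Suc N)\<close> are gained, enough to pass from
      the factor \<open>N - 1\<close> of the weaker alternative to \<open>N + 1\<close>.\<close>
    then have good: "2 * \<delta> (Suc N) \<le> L * D N - L * D (Suc N)"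
      using mult_left_mono[OF dec, of L] L_pos by (simp add: right_diff_distrib)
    have "(real N - 1) * \<delta> N + L * D N \<le> L * D 0"
      using IH nonneg[of N] by (auto simp: algebra_simps)
    \<comment> \<open>For \<open>N = 0\<close> the factor is negative and monotonicity would
      reverse; there the gain of the step suffices by itself.\<close>
    moreover have "(real N - 1) * \<delta> (Suc N) \<le> (real N - 1) * \<delta> N" if "N \<noteq> 0"
      using mono that by (intro mult_left_mono) auto
    moreover have "\<delta> (Suc N) + L * D (Suc N) \<le> L * D 0" if "N = 0"
      using that good nonneg[of "Suc N"] by simp
    ultimately have "(real N + 1) * \<delta> (Suc N) + L * D (Suc N) \<le> L * D 0"
      using good by (cases "N = 0") (auto simp: algebra_simps)
    then show ?thesis by (simp add: \<delta>_def D_def algebra_simps)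
  next
    assume cross: "h 1 (x N) \<noteq> h 2 (x N) \<and> h 1 (x (Suc N)) = h 2 (x (Suc N))"
    have "0 \<le> 2 * \<beta> N * \<delta> (Suc N)" using t nonneg[of "Suc N"] by simp
    with dec have "L * D (Suc N) \<le> L * D N" using L_pos by (intro mult_left_mono) auto
    moreover have "real N * \<delta> (Suc N) \<le> real N * \<delta> N" using mono by (rule mult_left_mono) simp
    \<comment> \<open>The functions differ at \<open>x N\<close>, so the induction hypothesis holds
      in its stronger form. Its factor \<open>N\<close> is \<open>Suc N - 1\<close>, as the weaker
      alternative for \<open>Suc N\<close> requires.\<close>
    ultimately have "real N * \<delta> (Suc N) + L * D (Suc N) \<le> L * D 0"
      using IH cross by linarith
    with cross show ?thesis by (simp add: \<delta>_def D_def)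
  qed
qed simp

theorem iteration_rate:
  assumes choice: "\<And>k. step_choice h A L (x k) (d k) (\<beta> k)"
    and step: "\<And>k. x (Suc k) = x k + \<beta> k *\<^sub>R d k"
    and min: "\<And>y. H z \<le> H y"
  shows "real N * (H (x N) - H z) \<le> L * (norm (x 0 - z))\<^sup>2"
proof -
  have D: "0 \<le> L * (norm (x N - z))\<^sup>2" using L_pos by simp
  show ?thesis
    using iteration_potential[of x d \<beta> z N, OF assms]
  proof
    assume equal: "h 1 (x N) = h 2 (x N) \<and>
      (real N - 1) * (H (x N) - H z) + L * (norm (x N - z))\<^sup>2 \<le> L * (norm (x 0 - z))\<^sup>2"
    \<comment> \<open>The one missing copy of the gap is paid for by the distance term
      \<open>L * (norm (x N - z))\<^sup>2\<close>, of which at most half is used.\<close>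
    then have "H (x N) - H z \<le> L / 2 * (norm (x N - z))\<^sup>2"
      using H_gap_at_equal[of z "x N"] min by blast
    with D equal show ?thesis by (simp add: algebra_simps)
  qed (use D in simp)
qed

end

section \<open>Iteration counts and the original problem\<close>

text \<open>About \<open>C / \<epsilon>\<close> iterations suffice. The first conclusion ensures
  that the \<open>LEAST\<close> in the second one is attained.\<close>

lemma inverse_rate_iteration_count:
  fixes e :: "nat \<Rightarrow> real"
  assumes rate: "\<And>N. N \<ge> 1 \<Longrightarrow> e N \<le> C / real N" and "0 \<le> C"
  shows "\<forall>\<epsilon>>0. \<exists>N. e N \<le> \<epsilon>"
    and "(\<lambda>\<epsilon>. real (LEAST N. e N \<le> \<epsilon>)) \<in> O[at_right 0](\<lambda>\<epsilon>. 1 / \<epsilon>)"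
proof -
  define n where "n \<epsilon> = nat \<lceil>C / \<epsilon>\<rceil> + 1" for \<epsilon>
  have n: "e (n \<epsilon>) \<le> \<epsilon>" if "\<epsilon> > 0" for \<epsilon>
  proof -
    have "C / \<epsilon> \<le> real (n \<epsilon>)" unfolding n_def by linarith
    then have "C / real (n \<epsilon>) \<le> \<epsilon>" using that by (simp add: n_def field_simps)
    moreover have "e (n \<epsilon>) \<le> C / real (n \<epsilon>)" by (rule rate) (simp add: n_def)
    ultimately show ?thesis by simp
  qed
  then show "\<forall>\<epsilon>>0. \<exists>N. e N \<le> \<epsilon>" by blast
  have "norm (real (LEAST N. e N \<le> \<epsilon>)) \<le> (C + 2) * norm (1 / \<epsilon>)" if "0 < \<epsilon>" "\<epsilon> < 1" for \<epsilon>
  proof -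
    have "(LEAST N. e N \<le> \<epsilon>) \<le> n \<epsilon>" using n[OF that(1)] by (rule Least_le)
    then have "real (LEAST N. e N \<le> \<epsilon>) \<le> real (n \<epsilon>)" by simp
    also have "\<dots> \<le> C / \<epsilon> + 2"
      using divide_nonneg_pos[OF \<open>0 \<le> C\<close> that(1)] unfolding n_def by linarith
    \<comment> \<open>The 2 comes from rounding up and from the added 1 in \<open>n\<close>; it is
      absorbed because \<open>\<epsilon> < 1\<close>.\<close>
    also have "\<dots> \<le> (C + 2) * (1 / \<epsilon>)" using that by (simp add: field_simps)
    finally show ?thesis using that by simp
  qed
  then have "\<forall>\<^sub>F \<epsilon> in at_right 0. norm (real (LEAST N. e N \<le> \<epsilon>)) \<le> (C + 2) * norm (1 / \<epsilon>)"
    unfolding eventually_at_right_field by (intro exI[of _ 1]) auto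
  then show "(\<lambda>\<epsilon>. real (LEAST N. e N \<le> \<epsilon>)) \<in> O[at_right 0](\<lambda>\<epsilon>. 1 / \<epsilon>)"
    by (rule bigoI)
qed

theorem theorem3p8:
  fixes Q1 Q2 :: "real^'n^'n" and b1 b2 :: "real^'n" and c L :: real
    and f1 f2 H :: "real^'n \<Rightarrow> real"
    and lam :: "nat \<Rightarrow> real"
    and h :: "nat \<Rightarrow> real^'n \<Rightarrow> real" and A :: "nat \<Rightarrow> real^'n^'n"
    and x d :: "nat \<Rightarrow> real^'n" and \<beta> :: "nat \<Rightarrow> real" and xstar :: "real^'n"
  assumes f1: "f1 = (\<lambda>y. 1/2 * (y \<bullet> (Q1 *v y)) + b1 \<bullet> y)"
    and f2: "f2 = (\<lambda>y. 1/2 * (y \<bullet> (Q2 *v y)) + b2 \<bullet> y + c)"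
    and sym: "transpose Q1 = Q1" "transpose Q2 = Q2"
    and null: "null_space Q1 \<inter> null_space Q2 = {0}"
    and nonconvex: "\<not> (convex_on UNIV f1 \<and> convex_on UNIV f2)"
    and slater: "\<exists>y. f2 y < 0"
    and interval: "{l. 0 \<le> l \<and> psd (Q1 + l *\<^sub>R Q2)} = {lam 1 .. lam 2}"
    and lam: "lam 1 < lam 2"
    and h: "h = (\<lambda>i y. f1 y + lam i * f2 y)"
    and A: "A = (\<lambda>i. Q1 + lam i *\<^sub>R Q2)"
    and H: "H = (\<lambda>y. max (h 1 y) (h 2 y))"
    and L: "L = max (lambda_max (A 1)) (lambda_max (A 2))"
    and choice: "\<And>k. step_choice h A L (x k) (d k) (\<beta> k)"
    and step: "\<And>k. x (Suc k) = x k + \<beta> k *\<^sub>R d k"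
    and minimizer: "is_arg_min H (\<lambda>_. True) xstar"
  shows "(\<forall>N\<ge>1. H (x N) - H xstar \<le> L / real N * (norm (x 0 - xstar))\<^sup>2) \<and>
         (\<forall>\<epsilon>>0. \<exists>N. H (x N) - H xstar \<le> \<epsilon>) \<and>
         (\<lambda>\<epsilon>. real (LEAST N. H (x N) - H xstar \<le> \<epsilon>)) \<in> O[at_right 0](\<lambda>\<epsilon>. 1 / \<epsilon>)"
proof -
  have lam_mem: "lam i \<in> {lam 1..lam 2}" if "i \<in> {1, 2}" for i
    using that lam by auto
  have psd_A: "psd (A i)" if "i \<in> {1, 2}" for i
    using lam_mem[OF that] unfolding interval[symmetric] by (simp add: A)
  have sym_A: "transpose (A i) = A i" for i
    using sym by (simp add: A vec_eq_iff transpose_def)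
  have convex_A: "0 \<le> v \<bullet> (A i *v v)" if "i \<in> {1, 2}" for i v
    using psd_A[OF that] by (simp add: psd_def)
  have smooth_A: "v \<bullet> (A i *v v) \<le> L * (v \<bullet> v)" if "i \<in> {1, 2}" for i v
  proof -
    have "lambda_max (A i) \<le> L" using that by (auto simp: L)
    then have "lambda_max (A i) * (v \<bullet> v) \<le> L * (v \<bullet> v)" by (simp add: mult_right_mono)
    with rayleigh_le_lambda_max[OF sym_A, of v i] show ?thesis by linarith
  qed
  have A_apply: "A i *v v = Q1 *v v + lam i *\<^sub>R (Q2 *v v)" for i v
    by (simp add: A matrix_vector_mult_add_rdistrib scaleR_matrix_vector_assoc)
  \<comment> \<open>Otherwise both forms are squeezed to zero, so \<open>A 1\<close> and
    \<open>A 2\<close> vanish. As \<open>lam 1\<close> and \<open>lam 2\<close> differ,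
    \<open>Q1\<close> and \<open>Q2\<close> vanish too, against the trivial common null
    space.\<close>
  have L_pos: "0 < L"
  proof (rule ccontr)
    assume "\<not> 0 < L"
    then have "A i *v v = 0" if "i \<in> {1, 2}" for i v
      using convex_A[OF that, of v] smooth_A[OF that, of v] psd_A[OF that]
      by (intro psd_dot_zero_imp_kernel) (auto intro: order_antisym
          simp: mult_nonpos_nonneg order_trans[of _ "L * (v \<bullet> v)" 0])
    from this[of 1] this[of 2] have zero: "Q1 *v v + lam 1 *\<^sub>R (Q2 *v v) = 0"
      "Q1 *v v + lam 2 *\<^sub>R (Q2 *v v) = 0" for v by (simp_all add: A_apply)
    have "Q2 *v v = 0" for v
    proof -
      have "(lam 2 - lam 1) *\<^sub>R (Q2 *v v) =
          (Q1 *v v + lam 2 *\<^sub>R (Q2 *v v)) - (Q1 *v v + lam 1 *\<^sub>R (Q2 *v v))"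
        by (simp add: scaleR_left_diff_distrib)
      then have "(lam 2 - lam 1) *\<^sub>R (Q2 *v v) = 0" by (simp only: zero diff_self)
      with lam show ?thesis by simp
    qed
    with zero(1) have "null_space Q1 \<inter> null_space Q2 = UNIV"
      by (simp add: null_space_def)
    with null show False by (metis UNIV_not_singleton)
  qed
  interpret M: max_quadratic h A "\<lambda>i. b1 + lam i *\<^sub>R b2" "\<lambda>i. lam i * c" L
  proof
    show "h i = (\<lambda>y. 1/2 * (y \<bullet> (A i *v y)) + (b1 + lam i *\<^sub>R b2) \<bullet> y + lam i * c)" for i
      by (simp add: h f1 f2 A_apply fun_eq_iff inner_add_left inner_add_right algebra_simps)
  qed (fact sym_A convex_A smooth_A L_pos)+
  have H_eq: "M.H = H" by (simp add: fun_eq_iff M.H_def H)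
  define C where "C = L * (norm (x 0 - xstar))\<^sup>2"
  have "H xstar \<le> H y" for y using minimizer by (auto simp: is_arg_min_def not_less)
  then have rate: "real N * (H (x N) - H xstar) \<le> C" for N
    using M.iteration_rate[of x d \<beta> xstar N] choice step by (simp add: H_eq C_def)
  have "H (x N) - H xstar \<le> C / real N" if "N \<ge> 1" for N
    using rate[of N] that by (simp add: field_simps)
  moreover have "0 \<le> C" using L_pos by (simp add: C_def)
  ultimately show ?thesis
    using inverse_rate_iteration_count[of "\<lambda>N. H (x N) - H xstar" C] by (simp add: C_def)
qed

end
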